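(* Let $n\ge 1$ and let $A\in\mathbb{C}^{2^n\times 2^n}$, $A\neq 0$, with rows and columns indexed by $0,\dots,2^n-1$. Let $v_{\mathrm{data}}=(v_{\mathrm{data},k})_{k=0}^{N-1}$, $v_{\mathrm{sign}}=(v_{\mathrm{sign},k})_{k=0}^{N-1}$, the diagonal offsets $d_k$ and the row sets $S_r(k)$ be the data collected from $A$ as described in the context, let $m=\lceil\log_2 N\rceil$, and let $f_k(j)=(j+d_k)\bmod 2^n\in\{0,\dots,2^n-1\}$. Consider the space $(\mathbb{C}^2)^{\otimes m}\otimes\mathbb{C}^2\otimes(\mathbb{C}^2)^{\otimes n}$ (data, delete and matrix registers, in this order). Suppose that: (i) $O_{\mathrm{shift}}$ is a unitary on this space with $$O_{\mathrm{shift}}\,|k\rangle_{\mathrm{data}}|b\rangle_{\mathrm{del}}|j\rangle=|k\rangle_{\mathrm{data}}|b\rangle_{\mathrm{del}}|f_k(j)\rangle ;$$ (ii) $O_{\mathrm{del}}$ is a unitary on this space with $$O_{\mathrm{del}}\,|k\rangle_{\mathrm{data}}|b\rangle_{\mathrm{del}}|f_k(j)\rangle=|k\rangle_{\mathrm{data}}|b\oplus\chi_k(f_k(j))\rangle_{\mathrm{del}}|f_k(j)\rangle,$$ where $\chi_k(i)=0$ if $i\in S_r(k)$ and $\chi_k(i)=1$ otherwise; both for all $k\in\{0,\dots,N-1\}$, $b\in\{0,1\}$, $j\in\{0,\dots,2^n-1\}$; (iii) $\mathrm{PREP}$ and $\mathrm{UNPREP}$ are unitaries on the data register $(\mathbb{C}^2)^{\otimes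 m}$ with $$\mathrm{PREP}\,|0\rangle^{\otimes m}_{\mathrm{data}}=\frac{1}{\sqrt{\sum_{k=0}^{N-1}v_{\mathrm{data},k}}}\sum_{k=0}^{N-1}v_{\mathrm{sign},k}\sqrt{v_{\mathrm{data},k}}\,|k\rangle_{\mathrm{data}},$$ $$\mathrm{UNPREP}^{\dagger}\,|0\rangle^{\otimes m}_{\mathrm{data}}=\frac{1}{\sqrt{\sum_{k=0}^{N-1}v_{\mathrm{data},k}}}\sum_{k=0}^{N-1}\sqrt{v_{\mathrm{data},k}}\,|k\rangle_{\mathrm{data}}$$ (all amplitudes on basis states $|k\rangle$ with $N\le k\le 2^m-1$ are zero). Then the unitary $$U_A=(\mathrm{UNPREP}\otimes I_{2^{n+1}})\,O_{\mathrm{del}}\,O_{\mathrm{shift}}\,(\mathrm{PREP}\otimes I_{2^{n+1}})$$ is a block encoding of $A$ with subnormalization $\alpha=\sum_{k=0}^{N-1}v_{\mathrm{data},k}$, i.e. for all $i,j\in\{0,\dots,2^n-1\}$, $$\big(\langle 0|^{\otimes m}_{\mathrm{data}}\langle 0|_{\mathrm{del}}\langle i|\big)\,U_A\,\big(|0\rangle^{\otimes m}_{\mathrm{data}}|0\rangle_{\mathrm{del}}|j\rangle\big)=\frac{A_{ij}}{\alpha}.$$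
   Context: Integers $j\in\{0,\dots,2^n-1\}$ label computational basis states $|j\rangle$ of $n$ qubits via binary expansion, and similarly $|k\rangle_{\mathrm{data}}$, $0\le k\le 2^m-1$, for the $m$ data qubits. $I_D$ is the $D\times D$ identity and $\oplus$ is addition mod 2. Collected data of $A$. For each diagonal offset $d\in\{-(2^n-1),\dots,2^n-1\}$ let $S_d=\{A_{ij} : A_{ij}\ne 0,\ i-j=d\}$ be the set of distinct nonzero values on the diagonal $i-j=d$, enumerated as $s_{d,1},\dots,s_{d,|S_d|}$ (entries on the same diagonal are identified iff they are equal as complex numbers). For each such value let $S_r(s_{d,l})=\{\,i\in\{0,\dots,2^n-1\} : 0\le i-d\le 2^n-1,\ A_{i,i-d}=s_{d,l}\,\}$ be the set of rows in which the value occurs on that diagonal. Let $\mathcal I$ be the set of triples $(d,l,c)$ with $d$ a diagonal offset, $1\le l\le |S_d|$, $c\in\{R,I\}$, such that $\mathrm{Re}(s_{d,l})\neq0$ if $c=R$ and $\mathrm{Im}(s_{d,l})\ne 0$ if $c=I$. Let $N=|\mathcal I|$ and fix an enumeration of $\mathcal I$ by $k\in\{0,\dots,N-1\}$, $k\mapsto(d(k),l(k),c(k))$. Then, writing $s=s_{d(k),l(k)}$ and $\mathrm{sgn}(a)=a/|a|$ for real $a\ne0$: - $v_{\mathrm{data},k}=|\mathrm{Re}(s)|$ if $c(k)=R$, and $|\mathrm{Im}(s)|$ if $c(k)=I$; - $v_{\mathrm{sign},k}=\mathrm{sgn}(\mathrm{Re}(s))$ if $c(k)=R$, and $\mathrm{sgn}(\mathrm{Im}(s))\,\mathrm{i}$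 if $c(k)=I$, where $\mathrm{i}$ is the imaginary unit; - $d_k=d(k)$ and $S_r(k)=S_r(s_{d(k),l(k)})$. *)

theory Defs
  imports Complex_Main "Jordan_Normal_Form.Schur_Decomposition"
begin

section \<open>Registers, tensor products, unitaries\<close>

definition kron_vec :: "complex vec \<Rightarrow> complex vec \<Rightarrow> complex vec" (infixr "\<otimes>\<^sub>v" 75) where
  "u \<otimes>\<^sub>v v = vec (dim_vec u * dim_vec v) (\<lambda>i. u $ (i div dim_vec v) * v $ (i mod dim_vec v))"

definition kron_mat :: "complex mat \<Rightarrow> complex mat \<Rightarrow> complex mat" (infixr "\<otimes>\<^sub>m" 75) where
  "A \<otimes>\<^sub>m B = mat (dim_row A * dim_row B) (dim_col A * dim_col B)
     (\<lambda>(i, j). A $$ (i div dim_row B, j div dim_col B) * B $$ (i mod dim_row B, j mod dim_col B))"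

text \<open>The space of \<open>n\<close> qubits is the space of complex vectors of dimension \<open>2 ^ n\<close>.
  \<open>ket n j\<close> is the tensor product of the single-qubit basis states given by the \<open>n\<close> binary
  digits of \<open>j\<close>, most significant digit first; it is meaningful for \<open>j < 2 ^ n\<close>.
  In particular \<open>ket n 0\<close> is the \<open>n\<close>-fold tensor power of the zero state.\<close>

primrec ket :: "nat \<Rightarrow> nat \<Rightarrow> complex vec" where
  "ket 0 j = unit_vec 1 0"
| "ket (Suc n) j = ket n (j div 2) \<otimes>\<^sub>v unit_vec 2 (j mod 2)"

lemma ket_eq_unit_vec: "j < 2 ^ n \<Longrightarrow> ket n j = unit_vec (2 ^ n) j"
proof (induction n arbitrary: j)
  case 0
  then show ?case by simp
next
  case (Suc n)
  then have "j div 2 < 2 ^ n" by auto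
  then have IH: "ket n (j div 2) = unit_vec (2 ^ n) (j div 2)" by (rule Suc.IH)
  show ?case
  proof (rule eq_vecI)
    show "dim_vec (ket (Suc n) j) = dim_vec (unit_vec (2 ^ Suc n) j :: complex vec)"
      by (simp add: IH kron_vec_def)
    fix i assume "i < dim_vec (unit_vec (2 ^ Suc n) j :: complex vec)"
    then have i: "i < 2 ^ n * 2" by simp
    then have "i div 2 < 2 ^ n" by auto
    moreover have "i div 2 = j div 2 \<and> i mod 2 = j mod 2 \<longleftrightarrow> i = j"
      by (metis div_mult_mod_eq)
    ultimately show "ket (Suc n) j $ i = (unit_vec (2 ^ Suc n) j :: complex vec) $ i"
      using i Suc.prems by (auto simp: IH kron_vec_def unit_vec_def)
  qed
qed

definition unitary_mat :: "nat \<Rightarrow> complex mat \<Rightarrow> bool" where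
  "unitary_mat D U \<longleftrightarrow> U \<in> carrier_mat D D \<and> mat_adjoint U * U = 1\<^sub>m D \<and> U * mat_adjoint U = 1\<^sub>m D"

text \<open>The matrix element of \<open>U\<close> between the bra of \<open>x\<close> and the ket \<open>y\<close>; the operation
  \<open>\<bullet>c\<close> conjugates its second argument.\<close>

definition braket :: "complex vec \<Rightarrow> complex mat \<Rightarrow> complex vec \<Rightarrow> complex" where
  "braket x U y = (U *\<^sub>v y) \<bullet>c x"

text \<open>Basis states of the joint space: data (\<open>m\<close> qubits), delete (one qubit), matrix (\<open>n\<close> qubits).\<close>

definition state :: "nat \<Rightarrow> nat \<Rightarrow> nat \<Rightarrow> nat \<Rightarrow> nat \<Rightarrow> complex vec" where
  "state m n k b j = ket m k \<otimes>\<^sub>v ket 1 b \<otimes>\<^sub>v ket n j"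

definition block_encoding :: "nat \<Rightarrow> nat \<Rightarrow> complex mat \<Rightarrow> real \<Rightarrow> complex mat \<Rightarrow> bool" where
  "block_encoding m n U \<alpha> A \<longleftrightarrow>
     unitary_mat (2 ^ (m + 1 + n)) U \<and>
     (\<forall>i < 2 ^ n. \<forall>j < 2 ^ n.
        braket (state m n 0 0 i) U (state m n 0 0 j) = A $$ (i, j) / complex_of_real \<alpha>)"


section \<open>Data collected from a matrix\<close>

definition offsets :: "nat \<Rightarrow> int set" where
  "offsets n = {- (2 ^ n - 1) .. 2 ^ n - 1}"

definition diag_values :: "nat \<Rightarrow> complex mat \<Rightarrow> int \<Rightarrow> complex set" where
  "diag_values n A d =
     {A $$ (i, j) | i j. i < 2 ^ n \<and> j < 2 ^ n \<and> A $$ (i, j) \<noteq> 0 \<and> int i - int j = d}"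

text \<open>The rows in which the value \<open>z\<close> occurs on the diagonal with offset \<open>d\<close>.\<close>

definition value_rows :: "nat \<Rightarrow> complex mat \<Rightarrow> int \<Rightarrow> complex \<Rightarrow> nat set" where
  "value_rows n A d z =
     {i. i < 2 ^ n \<and> 0 \<le> int i - d \<and> int i - d \<le> 2 ^ n - 1 \<and> A $$ (i, nat (int i - d)) = z}"

definition enumerates_diag_values :: "nat \<Rightarrow> complex mat \<Rightarrow> (int \<Rightarrow> nat \<Rightarrow> complex) \<Rightarrow> bool" where
  "enumerates_diag_values n A s \<longleftrightarrow>
     (\<forall>d \<in> offsets n. bij_betw (s d) {1 .. card (diag_values n A d)} (diag_values n A d))"

datatype component = RePart | ImPart

fun part_of :: "component \<Rightarrow> complex \<Rightarrow> real" where
  "part_of RePart z = Re z"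
| "part_of ImPart z = Im z"

fun part_unit :: "component \<Rightarrow> complex" where
  "part_unit RePart = 1"
| "part_unit ImPart = \<i>"

type_synonym item = "int \<times> nat \<times> component"

definition items :: "nat \<Rightarrow> complex mat \<Rightarrow> (int \<Rightarrow> nat \<Rightarrow> complex) \<Rightarrow> item set" where
  "items n A s =
     {(d, l, c). d \<in> offsets n \<and> l \<in> {1 .. card (diag_values n A d)} \<and> part_of c (s d l) \<noteq> 0}"

text \<open>In the following, \<open>t k\<close> is the \<open>k\<close>-th item of a fixed enumeration of the items.\<close>

definition v_data :: "(int \<Rightarrow> nat \<Rightarrow> complex) \<Rightarrow> (nat \<Rightarrow> item) \<Rightarrow> nat \<Rightarrow> real" where
  "v_data s t k = (case t k of (d, l, c) \<Rightarrow> \<bar>part_of c (s d l)\<bar>)"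

definition v_sign :: "(int \<Rightarrow> nat \<Rightarrow> complex) \<Rightarrow> (nat \<Rightarrow> item) \<Rightarrow> nat \<Rightarrow> complex" where
  "v_sign s t k =
     (case t k of (d, l, c) \<Rightarrow> complex_of_real (sgn (part_of c (s d l))) * part_unit c)"

definition offset :: "(nat \<Rightarrow> item) \<Rightarrow> nat \<Rightarrow> int" where
  "offset t k = fst (t k)"

definition item_rows ::
  "nat \<Rightarrow> complex mat \<Rightarrow> (int \<Rightarrow> nat \<Rightarrow> complex) \<Rightarrow> (nat \<Rightarrow> item) \<Rightarrow> nat \<Rightarrow> nat set" where
  "item_rows n A s t k = (case t k of (d, l, c) \<Rightarrow> value_rows n A d (s d l))"

definition shift :: "nat \<Rightarrow> (nat \<Rightarrow> item) \<Rightarrow> nat \<Rightarrow> nat \<Rightarrow> nat" where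
  "shift n t k j = nat ((int j + offset t k) mod 2 ^ n)"

definition del_flag ::
  "nat \<Rightarrow> complex mat \<Rightarrow> (int \<Rightarrow> nat \<Rightarrow> complex) \<Rightarrow> (nat \<Rightarrow> item) \<Rightarrow> nat \<Rightarrow> nat \<Rightarrow> nat" where
  "del_flag n A s t k i = (if i \<in> item_rows n A s t k then 0 else 1)"

end

theory Submission
  imports Defs
begin

text \<open>
  Write the two prepared data states as superpositions of the basis states \<open>k\<close> with amplitudes
  \<open>a k\<close> and \<open>b k\<close>. Moving \<open>UNPREP\<close> to the bra, the matrix element is the sum over \<open>k\<close> of
  \<open>a k * cnj (b k)\<close> restricted to those \<open>k\<close> for which the shift sends \<open>j\<close> to \<open>i\<close> and the delete
  qubit stays \<open>0\<close>. Membership of \<open>i\<close> in the row set of \<open>k\<close> rules out wrap-around of the cyclic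
  shift, so these \<open>k\<close> are exactly the real and imaginary parts of the value
  \<open>A\<^sub>i\<^sub>j\<close> on the diagonal \<open>i - j\<close>, and the sum recombines them into \<open>A\<^sub>i\<^sub>j\<close>.
\<close>

section \<open>Tensor products and adjoints\<close>

text \<open>Each joint index is \<open>p * b + q\<close> with \<open>q < b\<close>, so the range
  splits into \<open>a\<close> blocks of length \<open>b\<close>. This is how sums over the indices
  of a tensor product are split into sums over its two factors.\<close>

lemma sum_div_mod:
  fixes f :: "nat \<Rightarrow> nat \<Rightarrow> 'a::comm_monoid_add"
  shows "(\<Sum>k<a * b. f (k div b) (k mod b)) = (\<Sum>p<a. \<Sum>q<b. f p q)"
proof -
  have block: "(\<Sum>k = p * b..<p * b + b. f (k div b) (k mod b)) = (\<Sum>q<b. f p q)" for p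
  proof -
    have "(\<Sum>k = p * b..<p * b + b. f (k div b) (k mod b)) =
        (\<Sum>q<b. f ((q + p * b) div b) ((q + p * b) mod b))"
      using sum.shift_bounds_nat_ivl[of "\<lambda>k. f (k div b) (k mod b)" 0 "p * b" b]
      by (simp only: add_0 add.commute atLeast0LessThan)
    also have "\<dots> = (\<Sum>q<b. f p q)"
      by (rule sum.cong) auto
    finally show ?thesis .
  qed
  show ?thesis
    by (simp only: sum.nat_group[symmetric] block)
qed

lemma div_mod_less_mult:
  fixes i a b :: nat
  assumes "i < a * b"
  shows "i div b < a" "i mod b < b"
proof -
  show "i div b < a" using assms by (rule less_mult_imp_div_less)
  have "0 < b" using assms by (cases b) simp_all
  then show "i mod b < b" by (rule mod_less_divisor)
qed

lemma dim_kron_vec [simp]: "dim_vec (u \<otimes>\<^sub>v v) = dim_vec u * dim_vec v"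
  by (simp add: kron_vec_def)

lemma index_kron_vec [simp]:
  "i < dim_vec u * dim_vec v \<Longrightarrow> (u \<otimes>\<^sub>v v) $ i = u $ (i div dim_vec v) * v $ (i mod dim_vec v)"
  by (simp add: kron_vec_def)

lemma dim_kron_mat [simp]:
  "dim_row (A \<otimes>\<^sub>m B) = dim_row A * dim_row B"
  "dim_col (A \<otimes>\<^sub>m B) = dim_col A * dim_col B"
  by (simp_all add: kron_mat_def)

lemma index_kron_mat [simp]:
  assumes "i < dim_row A * dim_row B" "j < dim_col A * dim_col B"
  shows "(A \<otimes>\<^sub>m B) $$ (i, j) =
    A $$ (i div dim_row B, j div dim_col B) * B $$ (i mod dim_row B, j mod dim_col B)"
  using assms by (simp add: kron_mat_def)

lemma kron_mat_carrier [simp]: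
  "A \<in> carrier_mat a b \<Longrightarrow> B \<in> carrier_mat c d \<Longrightarrow> A \<otimes>\<^sub>m B \<in> carrier_mat (a * c) (b * d)"
  by (intro carrier_matI) simp_all

text \<open>Once the joint column index is split, the summand is a term in \<open>p\<close> times a
  term in \<open>q\<close>, so the double sum factors into the two matrix-vector products.\<close>

lemma kron_mat_mult_vec:
  assumes "dim_col A = dim_vec u" "dim_col B = dim_vec v"
  shows "(A \<otimes>\<^sub>m B) *\<^sub>v (u \<otimes>\<^sub>v v) = (A *\<^sub>v u) \<otimes>\<^sub>v (B *\<^sub>v v)"
proof (rule eq_vecI)
  fix i assume "i < dim_vec ((A *\<^sub>v u) \<otimes>\<^sub>v (B *\<^sub>v v))"
  then have i: "i < dim_row A * dim_row B" by simp
  note di = div_mod_less_mult[OF i]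
  let ?f = "\<lambda>p q. A $$ (i div dim_row B, p) * B $$ (i mod dim_row B, q) * (u $ p * v $ q)"
  have "((A \<otimes>\<^sub>m B) *\<^sub>v (u \<otimes>\<^sub>v v)) $ i =
      (\<Sum>k<dim_vec u * dim_vec v. ?f (k div dim_vec v) (k mod dim_vec v))"
    using i assms by (simp add: scalar_prod_def atLeast0LessThan)
  also have "\<dots> = (\<Sum>p<dim_vec u. \<Sum>q<dim_vec v. ?f p q)" by (rule sum_div_mod)
  also have "\<dots> = ((A *\<^sub>v u) \<otimes>\<^sub>v (B *\<^sub>v v)) $ i"
    using i di assms by (simp add: scalar_prod_def atLeast0LessThan sum_product mult_ac)
  finally show "((A \<otimes>\<^sub>m B) *\<^sub>v (u \<otimes>\<^sub>v v)) $ i = ((A *\<^sub>v u) \<otimes>\<^sub>v (B *\<^sub>v v)) $ i" .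
qed simp

lemma kron_mat_mult:
  assumes "dim_col A = dim_row C" "dim_col B = dim_row D"
  shows "(A \<otimes>\<^sub>m B) * (C \<otimes>\<^sub>m D) = (A * C) \<otimes>\<^sub>m (B * D)"
proof (rule eq_matI)
  fix i j assume "i < dim_row ((A * C) \<otimes>\<^sub>m (B * D))" "j < dim_col ((A * C) \<otimes>\<^sub>m (B * D))"
  then have ij: "i < dim_row A * dim_row B" "j < dim_col C * dim_col D" by simp_all
  note d = div_mod_less_mult[OF ij(1)] div_mod_less_mult[OF ij(2)]
  let ?f = "\<lambda>p q. A $$ (i div dim_row B, p) * B $$ (i mod dim_row B, q) *
    (C $$ (p, j div dim_col D) * D $$ (q, j mod dim_col D))"
  have "((A \<otimes>\<^sub>m B) * (C \<otimes>\<^sub>m D)) $$ (i, j) =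
      (\<Sum>k<dim_row C * dim_row D. ?f (k div dim_row D) (k mod dim_row D))"
    using ij assms by (simp add: scalar_prod_def atLeast0LessThan)
  also have "\<dots> = (\<Sum>p<dim_row C. \<Sum>q<dim_row D. ?f p q)" by (rule sum_div_mod)
  also have "\<dots> = ((A * C) \<otimes>\<^sub>m (B * D)) $$ (i, j)"
    using ij d assms by (simp add: scalar_prod_def atLeast0LessThan sum_product mult_ac)
  finally show "((A \<otimes>\<^sub>m B) * (C \<otimes>\<^sub>m D)) $$ (i, j) = ((A * C) \<otimes>\<^sub>m (B * D)) $$ (i, j)" .
qed simp_all

lemma kron_mat_one [simp]: "1\<^sub>m a \<otimes>\<^sub>m 1\<^sub>m b = 1\<^sub>m (a * b)"
proof (rule eq_matI)
  fix i j assume "i < dim_row (1\<^sub>m (a * b) :: complex mat)" "j < dim_col (1\<^sub>m (a * b) :: complex mat)"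
  then have ij: "i < a * b" "j < a * b" by simp_all
  have "i div b = j div b \<and> i mod b = j mod b \<longleftrightarrow> i = j" by (metis div_mult_mod_eq)
  then show "(1\<^sub>m a \<otimes>\<^sub>m 1\<^sub>m b) $$ (i, j) = (1\<^sub>m (a * b) :: complex mat) $$ (i, j)"
    using ij div_mod_less_mult[OF ij(1)] div_mod_less_mult[OF ij(2)] by auto
qed simp_all

lemma cscalar_prod_kron_vec:
  assumes "dim_vec u = dim_vec x" "dim_vec v = dim_vec y"
  shows "(u \<otimes>\<^sub>v v) \<bullet>c (x \<otimes>\<^sub>v y) = (u \<bullet>c x) * (v \<bullet>c y)"
proof -
  let ?f = "\<lambda>p q. u $ p * v $ q * cnj (x $ p * y $ q)"
  have "(u \<otimes>\<^sub>v v) \<bullet>c (x \<otimes>\<^sub>v y) = (\<Sum>k<dim_vec x * dim_vec y. ?f (k div dim_vec y) (k mod dim_vec y))"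
    using assms by (simp add: scalar_prod_def atLeast0LessThan)
  also have "\<dots> = (\<Sum>p<dim_vec x. \<Sum>q<dim_vec y. ?f p q)" by (rule sum_div_mod)
  also have "\<dots> = (u \<bullet>c x) * (v \<bullet>c y)"
    using assms by (simp add: scalar_prod_def atLeast0LessThan sum_product mult_ac)
  finally show ?thesis .
qed

section \<open>Adjoints of complex matrices\<close>

lemma dim_mat_adjoint [simp]:
  "dim_row (mat_adjoint A) = dim_col A" "dim_col (mat_adjoint A) = dim_row A"
  by (simp_all add: mat_adjoint_def)

lemma index_mat_adjoint [simp]:
  fixes A :: "complex mat"
  shows "i < dim_col A \<Longrightarrow> j < dim_row A \<Longrightarrow> mat_adjoint A $$ (i, j) = cnj (A $$ (j, i))"
  by (simp add: mat_adjoint_def mat_of_rows_index)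

lemma mat_adjoint_kron: "mat_adjoint (A \<otimes>\<^sub>m B) = mat_adjoint A \<otimes>\<^sub>m mat_adjoint B"
  by (rule eq_matI) (auto simp: div_mod_less_mult)

lemma mat_adjoint_one [simp]: "mat_adjoint (1\<^sub>m n) = (1\<^sub>m n :: complex mat)"
  by (rule eq_matI) auto

lemma mat_adjoint_mult:
  fixes A B :: "complex mat"
  assumes "dim_col A = dim_row B"
  shows "mat_adjoint (A * B) = mat_adjoint B * mat_adjoint A"
  using assms by (intro eq_matI) (auto simp: scalar_prod_def mult.commute)

text \<open>Both sides are the same double sum, taken in the two orders of summation. This moves an
  operator from the ket to the bra.\<close>

lemma cscalar_prod_mult_mat_vec:
  fixes A :: "complex mat"
  assumes A: "A \<in> carrier_mat a b" and u: "u \<in> carrier_vec b" and v: "v \<in> carrier_vec a"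
  shows "(A *\<^sub>v u) \<bullet>c v = u \<bullet>c (mat_adjoint A *\<^sub>v v)"
proof -
  have "(A *\<^sub>v u) \<bullet>c v = (\<Sum>i = 0..<a. \<Sum>j = 0..<b. A $$ (i, j) * u $ j * cnj (v $ i))"
    using assms by (simp add: scalar_prod_def sum_distrib_right)
  also have "\<dots> = (\<Sum>j = 0..<b. \<Sum>i = 0..<a. A $$ (i, j) * u $ j * cnj (v $ i))"
    by (rule sum.swap)
  also have "\<dots> = u \<bullet>c (mat_adjoint A *\<^sub>v v)"
    using assms by (simp add: scalar_prod_def sum_distrib_left mult_ac)
  finally show ?thesis .
qed

lemma cscalar_prod_smult:
  fixes u v :: "complex vec"
  assumes "dim_vec u = dim_vec v"
  shows "(c \<cdot>\<^sub>v u) \<bullet>c (e \<cdot>\<^sub>v v) = c * cnj e * (u \<bullet>c v)"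
  using assms by (simp add: scalar_prod_def sum_distrib_left mult_ac)

section \<open>Unitarity of products and tensor products\<close>

lemma unitary_mat_mult:
  assumes U: "unitary_mat D U" and V: "unitary_mat D V"
  shows "unitary_mat D (U * V)"
proof -
  have c: "U \<in> carrier_mat D D" "V \<in> carrier_mat D D"
    using U V by (simp_all add: unitary_mat_def)
  have c': "mat_adjoint U \<in> carrier_mat D D" "mat_adjoint V \<in> carrier_mat D D"
    using c by (auto intro!: carrier_matI)
  have adj: "mat_adjoint (U * V) = mat_adjoint V * mat_adjoint U"
    using c by (intro mat_adjoint_mult) simp
  have "(mat_adjoint V * mat_adjoint U) * (U * V) = mat_adjoint V * (mat_adjoint U * (U * V))"
    by (rule assoc_mult_mat[OF c'(2,1) mult_carrier_mat[OF c]])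
  also have "mat_adjoint U * (U * V) = (mat_adjoint U * U) * V"
    by (rule assoc_mult_mat[OF c'(1) c, symmetric])
  also have "\<dots> = V"
    using U c(2) by (simp add: unitary_mat_def)
  also have "mat_adjoint V * V = 1\<^sub>m D"
    using V by (simp add: unitary_mat_def)
  finally have left: "(mat_adjoint V * mat_adjoint U) * (U * V) = 1\<^sub>m D" .
  have "(U * V) * (mat_adjoint V * mat_adjoint U) = U * (V * (mat_adjoint V * mat_adjoint U))"
    by (rule assoc_mult_mat[OF c mult_carrier_mat[OF c'(2,1)]])
  also have "V * (mat_adjoint V * mat_adjoint U) = (V * mat_adjoint V) * mat_adjoint U"
    by (rule assoc_mult_mat[OF c(2) c'(2,1), symmetric])
  also have "\<dots> = mat_adjoint U"
    using V left_mult_one_mat[OF c'(1)] by (simp add: unitary_mat_def)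
  also have "U * mat_adjoint U = 1\<^sub>m D"
    using U by (simp add: unitary_mat_def)
  finally have right: "(U * V) * (mat_adjoint V * mat_adjoint U) = 1\<^sub>m D" .
  show ?thesis
    using mult_carrier_mat[OF c] left right by (simp add: unitary_mat_def adj)
qed

lemma unitary_mat_kron:
  assumes U: "unitary_mat a U" and V: "unitary_mat b V"
  shows "unitary_mat (a * b) (U \<otimes>\<^sub>m V)"
proof -
  have c: "U \<in> carrier_mat a a" "V \<in> carrier_mat b b"
    using U V by (simp_all add: unitary_mat_def)
  have "mat_adjoint (U \<otimes>\<^sub>m V) * (U \<otimes>\<^sub>m V) = (mat_adjoint U * U) \<otimes>\<^sub>m (mat_adjoint V * V)"
    "(U \<otimes>\<^sub>m V) * mat_adjoint (U \<otimes>\<^sub>m V) = (U * mat_adjoint U) \<otimes>\<^sub>m (V * mat_adjoint V)"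
    unfolding mat_adjoint_kron by (rule kron_mat_mult; use c in simp)+
  then show ?thesis
    using U V c by (simp add: unitary_mat_def)
qed

lemma unitary_mat_one: "unitary_mat n (1\<^sub>m n)"
  by (simp add: unitary_mat_def)

section \<open>Finite superpositions\<close>

lemma dim_finsum_vec [simp]:
  "f \<in> K \<rightarrow> carrier_vec n \<Longrightarrow> dim_vec (finsum_vec TYPE(complex) n f K) = n"
  by (rule carrier_vecD[OF finsum_vec_closed])

text \<open>\<open>finsum_vec\<close> carries a fixed dimension, which changes here from
  \<open>n\<close> to \<open>n * d\<close>; coordinatewise the claim is distributivity of a product
  over a finite sum.\<close>

lemma kron_vec_finsum:
  assumes K: "finite K" and f: "f \<in> K \<rightarrow> carrier_vec n" and w: "w \<in> carrier_vec d"
  shows "finsum_vec TYPE(complex) n f K \<otimes>\<^sub>v w = finsum_vec TYPE(complex) (n * d) (\<lambda>k. f k \<otimes>\<^sub>v w) K"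
proof -
  have df: "dim_vec (f k) = n" if "k \<in> K" for k
    using f that by (rule funcset_mem[THEN carrier_vecD])
  have dw: "dim_vec w = d" using w by (rule carrier_vecD)
  have g: "(\<lambda>k. f k \<otimes>\<^sub>v w) \<in> K \<rightarrow> carrier_vec (n * d)"
    by (intro funcsetI carrier_vecI) (simp add: df dw)
  show ?thesis
  proof (rule eq_vecI)
    fix i assume "i < dim_vec (finsum_vec TYPE(complex) (n * d) (\<lambda>k. f k \<otimes>\<^sub>v w) K)"
    then have i: "i < n * d" using g by simp
    have "(finsum_vec TYPE(complex) n f K \<otimes>\<^sub>v w) $ i = (\<Sum>k\<in>K. f k $ (i div d)) * w $ (i mod d)"
      using i f dw by (simp add: index_finsum_vec[OF K div_mod_less_mult(1)[OF i] f])
    also have "\<dots> = (\<Sum>k\<in>K. (f k \<otimes>\<^sub>v w) $ i)"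
      unfolding sum_distrib_right using i by (intro sum.cong) (simp_all add: df dw)
    finally show "(finsum_vec TYPE(complex) n f K \<otimes>\<^sub>v w) $ i =
        finsum_vec TYPE(complex) (n * d) (\<lambda>k. f k \<otimes>\<^sub>v w) K $ i"
      by (simp add: index_finsum_vec[OF K i g])
  qed (use f g dw in simp)
qed

lemma mult_mat_vec_finsum:
  assumes K: "finite K" and f: "f \<in> K \<rightarrow> carrier_vec n" and A: "A \<in> carrier_mat a n"
  shows "A *\<^sub>v finsum_vec TYPE(complex) n f K = finsum_vec TYPE(complex) a (\<lambda>k. A *\<^sub>v f k) K"
proof -
  have g: "(\<lambda>k. A *\<^sub>v f k) \<in> K \<rightarrow> carrier_vec a"
    using mult_mat_vec_carrier[OF A] f by blast
  show ?thesis
  proof (rule eq_vecI)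
    fix i assume "i < dim_vec (finsum_vec TYPE(complex) a (\<lambda>k. A *\<^sub>v f k) K)"
    then have i: "i < a" using g by simp
    have "(A *\<^sub>v finsum_vec TYPE(complex) n f K) $ i = (\<Sum>j = 0..<n. A $$ (i, j) * (\<Sum>k\<in>K. f k $ j))"
      using assms i by (simp add: scalar_prod_def index_finsum_vec)
    also have "\<dots> = (\<Sum>k\<in>K. \<Sum>j = 0..<n. A $$ (i, j) * f k $ j)"
      by (subst sum.swap) (simp add: sum_distrib_left)
    also have "\<dots> = (\<Sum>k\<in>K. (A *\<^sub>v f k) $ i)"
    proof (rule sum.cong)
      fix k assume "k \<in> K"
      then have "dim_vec (f k) = n" using f by (auto dest: funcset_mem)
      then show "(\<Sum>j = 0..<n. A $$ (i, j) * f k $ j) = (A *\<^sub>v f k) $ i"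
        using A i by (simp add: scalar_prod_def)
    qed simp
    finally show "(A *\<^sub>v finsum_vec TYPE(complex) n f K) $ i =
        finsum_vec TYPE(complex) a (\<lambda>k. A *\<^sub>v f k) K $ i"
      using K g i by (simp add: index_finsum_vec)
  qed (use A g in simp)
qed

lemma cscalar_prod_finsum:
  assumes K: "finite K" and f: "f \<in> K \<rightarrow> carrier_vec n" and x: "x \<in> carrier_vec n"
  shows "finsum_vec TYPE(complex) n f K \<bullet>c x = (\<Sum>k\<in>K. f k \<bullet>c x)"
proof -
  have "finsum_vec TYPE(complex) n f K \<bullet>c x = (\<Sum>j = 0..<n. (\<Sum>k\<in>K. f k $ j) * cnj (x $ j))"
    using assms by (simp add: scalar_prod_def index_finsum_vec)
  also have "\<dots> = (\<Sum>k\<in>K. f k \<bullet>c x)"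
    using x by (subst sum_distrib_right, subst sum.swap) (simp add: scalar_prod_def)
  finally show ?thesis .
qed

lemma smult_kron_vec: "(c \<cdot>\<^sub>v u) \<otimes>\<^sub>v w = c \<cdot>\<^sub>v (u \<otimes>\<^sub>v w)"
proof (rule eq_vecI)
  fix i assume "i < dim_vec (c \<cdot>\<^sub>v (u \<otimes>\<^sub>v w))"
  then have i: "i < dim_vec u * dim_vec w" by simp
  then show "((c \<cdot>\<^sub>v u) \<otimes>\<^sub>v w) $ i = (c \<cdot>\<^sub>v (u \<otimes>\<^sub>v w)) $ i"
    by (simp add: div_mod_less_mult(1)[OF i])
qed simp

section \<open>Basis kets and their superpositions\<close>

lemma ket_carrier [simp]: "ket n j \<in> carrier_vec (2 ^ n)"
proof -
  have "dim_vec (ket n j) = 2 ^ n" for n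
    by (induction n arbitrary: j) simp_all
  then show ?thesis by (rule carrier_vecI)
qed

lemma dim_ket [simp]: "dim_vec (ket n j) = 2 ^ n"
  using ket_carrier by (rule carrier_vecD)

text \<open>From here on kets enter through their dimension and \<open>ket_eq_unit_vec\<close>; the
  recursive equations as rewrite rules would break up \<open>ket 1 b\<close>, the delete
  qubit.\<close>

declare ket.simps [simp del]

text \<open>The second argument of \<open>\<bullet>c\<close> is conjugated, so a basis ket in the
  first slot reads off a conjugated coordinate.\<close>

lemma ket_cscalar_prod:
  assumes "j < 2 ^ n" "v \<in> carrier_vec (2 ^ n)"
  shows "ket n j \<bullet>c v = cnj (v $ j)"
proof -
  have "ket n j \<bullet>c v = conjugate v $ j"
    unfolding ket_eq_unit_vec[OF assms(1)]
    by (rule scalar_prod_left_unit[OF carrier_vec_conjugate[OF assms(2)] assms(1)])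
  then show ?thesis using assms by simp
qed

lemma cscalar_prod_ket:
  assumes "j < 2 ^ n" "i < 2 ^ n"
  shows "ket n j \<bullet>c ket n i = (if i = j then 1 else 0)"
  by (subst ket_cscalar_prod[OF assms(1) ket_carrier], subst ket_eq_unit_vec[OF assms(2)])
     (use assms in simp)

text \<open>Labels below \<open>2 ^ m\<close> give distinct unit vectors, so at most one summand is
  nonzero at coordinate \<open>k\<close>.\<close>

lemma index_superposition:
  assumes "K \<subseteq> {..<2 ^ m}" "k < 2 ^ m"
  shows "finsum_vec TYPE(complex) (2 ^ m) (\<lambda>k. a k \<cdot>\<^sub>v ket m k) K $ k = (if k \<in> K then a k else 0)"
proof -
  have K: "finite K" using assms(1) finite_subset by blast
  have "finsum_vec TYPE(complex) (2 ^ m) (\<lambda>k. a k \<cdot>\<^sub>v ket m k) K $ k = (\<Sum>p\<in>K. (a p \<cdot>\<^sub>v ket m p) $ k)"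
    by (rule index_finsum_vec[OF K assms(2)]) auto
  also have "\<dots> = (\<Sum>p\<in>K. if k = p then a p else 0)"
    using assms by (intro sum.cong) (auto simp: ket_eq_unit_vec)
  also have "\<dots> = (if k \<in> K then a k else 0)"
    using K by simp
  finally show ?thesis .
qed

section \<open>Block encodings by linear combinations of basis-state maps\<close>

lemma state_carrier [simp]: "state m n k b j \<in> carrier_vec (2 ^ (m + 1 + n))"
  by (rule carrier_vecI) (simp add: state_def power_add)

text \<open>A single sum over \<open>k\<close> suffices because \<open>W\<close> preserves the data
  label: the term that \<open>P\<close> prepares with amplitude \<open>a k\<close> meets only the
  amplitude \<open>b k\<close> of the bra. The bound on \<open>N\<close> makes every
  \<open>k < N\<close> the label of a data basis state.\<close>

lemma braket_select:
  assumes P: "unitary_mat (2 ^ m) P" and Q: "unitary_mat (2 ^ m) Q"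
    and W: "W \<in> carrier_mat (2 ^ (m + 1 + n)) (2 ^ (m + 1 + n))"
    and N: "N \<le> 2 ^ m"
    and P0: "P *\<^sub>v ket m 0 = c \<cdot>\<^sub>v finsum_vec TYPE(complex) (2 ^ m) (\<lambda>k. a k \<cdot>\<^sub>v ket m k) {..<N}"
    and Q0: "mat_adjoint Q *\<^sub>v ket m 0 =
      e \<cdot>\<^sub>v finsum_vec TYPE(complex) (2 ^ m) (\<lambda>k. b k \<cdot>\<^sub>v ket m k) {..<N}"
    and W_state: "\<And>k. k < N \<Longrightarrow> W *\<^sub>v state m n k 0 j = state m n k (\<chi> k) (f k)"
    and \<chi>: "\<And>k. k < N \<Longrightarrow> \<chi> k < 2" and f: "\<And>k. k < N \<Longrightarrow> f k < 2 ^ n"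
    and i: "i < 2 ^ n"
  shows "braket (state m n 0 0 i)
      ((Q \<otimes>\<^sub>m 1\<^sub>m (2 ^ (n + 1))) * W * (P \<otimes>\<^sub>m 1\<^sub>m (2 ^ (n + 1)))) (state m n 0 0 j) =
    c * cnj e * (\<Sum>k<N. if \<chi> k = 0 \<and> f k = i then a k * cnj (b k) else 0)"
proof -
  define D :: nat where "D = 2 ^ (m + 1 + n)"
  \<comment> \<open>Delete and matrix register are merged into one factor, which matches the
    bracketing of \<open>state\<close> and the shape of \<open>P\<close> and \<open>Q\<close>
    tensored with an identity.\<close>
  define w where "w b j = ket 1 b \<otimes>\<^sub>v ket n j" for b j
  define P' Q' where "P' = P \<otimes>\<^sub>m 1\<^sub>m (2 ^ (n + 1))" and "Q' = Q \<otimes>\<^sub>m 1\<^sub>m (2 ^ (n + 1))"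
  have st: "state m n k b j = ket m k \<otimes>\<^sub>v w b j" for k b j
    by (simp add: state_def w_def)
  have D: "D = 2 ^ m * 2 ^ (n + 1)" by (simp add: D_def power_add)
  have w: "w b j \<in> carrier_vec (2 ^ (n + 1))" for b j
    by (rule carrier_vecI) (simp add: w_def)
  have Pc: "P \<in> carrier_mat (2 ^ m) (2 ^ m)" and Qc: "Q \<in> carrier_mat (2 ^ m) (2 ^ m)"
    using P Q by (auto simp: unitary_mat_def)
  have P'c: "P' \<in> carrier_mat D D" and Q'c: "Q' \<in> carrier_mat D D" and Wc: "W \<in> carrier_mat D D"
    using W unfolding P'_def Q'_def D_def[symmetric] D
    by (simp_all only: kron_mat_carrier[OF Pc] kron_mat_carrier[OF Qc] one_carrier_mat)
  have stc: "state m n k b j \<in> carrier_vec D" for k b j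
    unfolding D_def by (rule state_carrier)
  define u v where "u = finsum_vec TYPE(complex) (2 ^ m) (\<lambda>k. a k \<cdot>\<^sub>v ket m k) {..<N}"
    and "v = finsum_vec TYPE(complex) (2 ^ m) (\<lambda>k. b k \<cdot>\<^sub>v ket m k) {..<N}"
  have u: "u \<in> carrier_vec (2 ^ m)" and v: "v \<in> carrier_vec (2 ^ m)"
    unfolding u_def v_def by (auto intro!: finsum_vec_closed)
  have v_index: "v $ k = b k" if "k < N" for k
    using N that unfolding v_def by (subst index_superposition) auto
  have uw: "u \<otimes>\<^sub>v w 0 j = finsum_vec TYPE(complex) D (\<lambda>k. a k \<cdot>\<^sub>v state m n k 0 j) {..<N}"
    using w unfolding u_def D by (subst kron_vec_finsum) (auto simp: smult_kron_vec st)
  have P'_state: "P' *\<^sub>v state m n 0 0 j = c \<cdot>\<^sub>v (u \<otimes>\<^sub>v w 0 j)"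
    using Pc w[of 0 j] P0 unfolding P'_def st
    by (subst kron_mat_mult_vec) (auto simp: smult_kron_vec u_def)
  have Q'_state: "mat_adjoint Q' *\<^sub>v state m n 0 0 i = e \<cdot>\<^sub>v (v \<otimes>\<^sub>v w 0 i)"
    using Qc w[of 0 i] Q0 unfolding Q'_def st mat_adjoint_kron
    by (subst kron_mat_mult_vec) (auto simp: smult_kron_vec v_def)
  have vw: "v \<otimes>\<^sub>v w 0 i \<in> carrier_vec D" and uwc: "u \<otimes>\<^sub>v w 0 j \<in> carrier_vec D"
    using u v w D by (auto intro!: carrier_vecI)
  \<comment> \<open>The overlap factors over the registers: the data factor gives the conjugated
    amplitude, the other two give Kronecker deltas. The bounds on \<open>\<chi> k\<close> and
    \<open>f k\<close> ensure that these are genuine basis labels.\<close>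
  have inner: "state m n k (\<chi> k) (f k) \<bullet>c (v \<otimes>\<^sub>v w 0 i) =
      (if \<chi> k = 0 \<and> f k = i then cnj (b k) else 0)" if k: "k < N" for k
  proof -
    have "k < 2 ^ m" using k N by simp
    then have "ket m k \<bullet>c v = cnj (b k)"
      by (simp only: ket_cscalar_prod v v_index[OF k])
    moreover have "w (\<chi> k) (f k) \<bullet>c w 0 i = (if \<chi> k = 0 \<and> f k = i then 1 else 0)"
      using \<chi>[OF k] f[OF k] i unfolding w_def
      by (subst cscalar_prod_kron_vec) (auto simp: cscalar_prod_ket)
    ultimately show ?thesis
      using v w[of "\<chi> k" "f k"] w[of 0 i] unfolding st by (subst cscalar_prod_kron_vec) auto
  qed
  have Ww: "W *\<^sub>v (u \<otimes>\<^sub>v w 0 j) =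
      finsum_vec TYPE(complex) D (\<lambda>k. W *\<^sub>v (a k \<cdot>\<^sub>v state m n k 0 j)) {..<N}"
    unfolding uw by (rule mult_mat_vec_finsum) (use stc Wc in auto)
  have "braket (state m n 0 0 i) (Q' * W * P') (state m n 0 0 j) =
      (Q' *\<^sub>v (W *\<^sub>v (P' *\<^sub>v state m n 0 0 j))) \<bullet>c state m n 0 0 i"
    using P'c Q'c Wc stc unfolding braket_def
    by (simp add: assoc_mult_mat_vec[of _ D D _ D])
  also have "\<dots> = (W *\<^sub>v (P' *\<^sub>v state m n 0 0 j)) \<bullet>c (mat_adjoint Q' *\<^sub>v state m n 0 0 i)"
    using P'c Q'c Wc stc by (intro cscalar_prod_mult_mat_vec[of _ D D]) auto
  \<comment> \<open>The normalization of the bra comes out conjugated.\<close>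
  also have "\<dots> = c * cnj e * ((W *\<^sub>v (u \<otimes>\<^sub>v w 0 j)) \<bullet>c (v \<otimes>\<^sub>v w 0 i))"
    unfolding P'_state Q'_state mult_mat_vec[OF Wc uwc]
    by (rule cscalar_prod_smult) (simp only: dim_mult_mat_vec carrier_matD(1)[OF Wc] carrier_vecD[OF vw])
  also have "(W *\<^sub>v (u \<otimes>\<^sub>v w 0 j)) \<bullet>c (v \<otimes>\<^sub>v w 0 i) =
      (\<Sum>k<N. (W *\<^sub>v (a k \<cdot>\<^sub>v state m n k 0 j)) \<bullet>c (v \<otimes>\<^sub>v w 0 i))"
    unfolding Ww by (rule cscalar_prod_finsum) (use Wc vw stc in auto)
  also have "\<dots> = (\<Sum>k<N. if \<chi> k = 0 \<and> f k = i then a k * cnj (b k) else 0)"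
  proof (rule sum.cong)
    fix k assume "k \<in> {..<N}"
    then have k: "k < N" by simp
    have "(W *\<^sub>v (a k \<cdot>\<^sub>v state m n k 0 j)) \<bullet>c (v \<otimes>\<^sub>v w 0 i) =
        a k * (state m n k (\<chi> k) (f k) \<bullet>c (v \<otimes>\<^sub>v w 0 i))"
      using vw stc[of k "\<chi> k" "f k"] by (simp add: mult_mat_vec[OF Wc stc] W_state[OF k])
    then show "(W *\<^sub>v (a k \<cdot>\<^sub>v state m n k 0 j)) \<bullet>c (v \<otimes>\<^sub>v w 0 i) =
        (if \<chi> k = 0 \<and> f k = i then a k * cnj (b k) else 0)"
      by (simp add: inner[OF k])
  qed simp
  finally show ?thesis unfolding P'_def Q'_def .
qed

section \<open>Recovering the matrix entries\<close>

text \<open>The row condition puts \<open>i - d\<close> between \<open>0\<close> and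
  \<open>2 ^ n - 1\<close>. It is congruent to \<open>j\<close> modulo \<open>2 ^ n\<close>, and two
  numbers in that range that are congruent are equal. Conversely, \<open>j + d = i\<close> is
  already reduced.\<close>

lemma mem_value_rows_shift_iff:
  assumes "i < 2 ^ n" "j < 2 ^ n"
  shows "nat ((int j + d) mod 2 ^ n) = i \<and> i \<in> value_rows n A d z \<longleftrightarrow>
    d = int i - int j \<and> A $$ (i, j) = z"
proof
  assume L: "nat ((int j + d) mod 2 ^ n) = i \<and> i \<in> value_rows n A d z"
  then have d: "0 \<le> int i - d" "int i - d < 2 ^ n" and z: "A $$ (i, nat (int i - d)) = z"
    by (auto simp: value_rows_def)
  have "int i = (int j + d) mod 2 ^ n"
    using L by auto
  then have "(int i - d) mod 2 ^ n = int j mod 2 ^ n"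
    by (simp add: mod_diff_left_eq)
  moreover have "int j < 2 ^ n" using assms(2) by (metis of_nat_less_iff of_nat_numeral of_nat_power)
  ultimately have "int i - d = int j" using d by simp
  then show "d = int i - int j \<and> A $$ (i, j) = z" using z by auto
next
  assume R: "d = int i - int j \<and> A $$ (i, j) = z"
  have "int i < 2 ^ n" "int j < 2 ^ n"
    using assms by (metis of_nat_less_iff of_nat_numeral of_nat_power)+
  then show "nat ((int j + d) mod 2 ^ n) = i \<and> i \<in> value_rows n A d z"
    using R assms by (auto simp: value_rows_def)
qed

text \<open>The enumeration of a diagonal is injective, so a nonzero entry has exactly one index
  \<open>l\<close>. Only its real and imaginary items contribute, and they add up to the
  entry.\<close>

lemma sum_items_eq_entry:
  assumes s: "enumerates_diag_values n A s" and fin: "finite (items n A s)"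
    and i: "i < 2 ^ n" and j: "j < 2 ^ n"
  shows "(\<Sum>(d, l, c)\<in>items n A s.
      if d = int i - int j \<and> A $$ (i, j) = s d l
      then complex_of_real (part_of c (s d l)) * part_unit c else 0) = A $$ (i, j)"
    (is "sum ?g _ = _")
proof (cases "A $$ (i, j) = 0")
  case True
  \<comment> \<open>For a zero entry, a term whose condition holds is a part of the number
    zero.\<close>
  have "part_of c 0 = 0" for c by (cases c) simp_all
  then have "?g x = 0" for x using True by (auto split: prod.split)
  then show ?thesis using True by simp
next
  case False
  define d where "d = int i - int j"
  have "int i < 2 ^ n" "int j < 2 ^ n"
    using i j by (metis of_nat_less_iff of_nat_numeral of_nat_power)+
  then have d: "d \<in> offsets n" unfolding offsets_def d_def atLeastAtMost_iff by linarith
  have bij: "bij_betw (s d) {1..card (diag_values n A d)} (diag_values n A d)"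
    using s d by (simp add: enumerates_diag_values_def)
  have "A $$ (i, j) \<in> diag_values n A d"
    using i j False by (auto simp: diag_values_def d_def)
  then obtain l where l: "l \<in> {1..card (diag_values n A d)}" "s d l = A $$ (i, j)"
    using bij by (metis bij_betw_def imageE)
  have uniq: "l' = l" if "l' \<in> {1..card (diag_values n A d)}" "s d l' = A $$ (i, j)" for l'
    using bij l that by (metis bij_betw_def inj_on_eq_iff)
  \<comment> \<open>Neither set need contain the other: a triple whose part is zero is missing from
    \<open>items\<close>. Terms in either set difference vanish, by \<open>uniq\<close> on one side
    and by the zero part on the other.\<close>
  have "sum ?g (items n A s) = sum ?g {(d, l, RePart), (d, l, ImPart)}"
  proof (rule sum.mono_neutral_cong)
    fix x assume x: "x \<in> items n A s - {(d, l, RePart), (d, l, ImPart)}"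
    obtain d' l' c where "x = (d', l', c)" by (cases x)
    then show "?g x = 0"
      using x uniq[of l'] by (cases c) (auto simp: items_def d_def)
  next
    fix x assume "x \<in> {(d, l, RePart), (d, l, ImPart)} - items n A s"
    then show "?g x = 0" using d l by (auto simp: items_def split: if_splits)
  qed (use fin in auto)
  also have "\<dots> = A $$ (i, j)"
    using l by (simp add: d_def complex_eq_iff)
  finally show ?thesis .
qed

text \<open>The ceiling, also after truncation by \<open>nat\<close>, is at least the logarithm. The
  case \<open>N = 0\<close> is separate because \<open>2 powr log 2 x = x\<close> requires a
  positive \<open>x\<close>.\<close>

lemma le_two_power_log:
  assumes "m = nat \<lceil>log 2 (real N)\<rceil>"
  shows "N \<le> 2 ^ m"
proof (cases "N = 0")
  case False
  then have "real N = 2 powr log 2 (real N)" by simp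
  also have "\<dots> \<le> 2 powr real m"
    unfolding assms by (intro powr_mono) linarith+
  also have "\<dots> = real (2 ^ m)" by (simp add: powr_realpow)
  finally show ?thesis by simp
qed simp

theorem theorem1:
  fixes n m N :: nat
    and A O_shift O_del PREP UNPREP :: "complex mat"
    and s :: "int \<Rightarrow> nat \<Rightarrow> complex"
    and t :: "nat \<Rightarrow> item"
  assumes n: "n \<ge> 1"
    and A: "A \<in> carrier_mat (2 ^ n) (2 ^ n)" "A \<noteq> 0\<^sub>m (2 ^ n) (2 ^ n)"
    and s: "enumerates_diag_values n A s"
    and N: "N = card (items n A s)"
    and t: "bij_betw t {0..<N} (items n A s)"
    and m: "m = nat \<lceil>log 2 (real N)\<rceil>"
    and O_shift: "unitary_mat (2 ^ (m + 1 + n)) O_shift"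
      "\<forall>k < N. \<forall>b \<in> {0, 1}. \<forall>j < 2 ^ n.
         O_shift *\<^sub>v state m n k b j = state m n k b (shift n t k j)"
    and O_del: "unitary_mat (2 ^ (m + 1 + n)) O_del"
      "\<forall>k < N. \<forall>b \<in> {0, 1}. \<forall>j < 2 ^ n.
         O_del *\<^sub>v state m n k b (shift n t k j) =
         state m n k ((b + del_flag n A s t k (shift n t k j)) mod 2) (shift n t k j)"
    and PREP: "unitary_mat (2 ^ m) PREP"
      "PREP *\<^sub>v ket m 0 =
         complex_of_real (1 / sqrt (\<Sum>k<N. v_data s t k)) \<cdot>\<^sub>v
         finsum_vec TYPE(complex) (2 ^ m)
           (\<lambda>k. (v_sign s t k * complex_of_real (sqrt (v_data s t k))) \<cdot>\<^sub>v ket m k) {..<N}"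
    and UNPREP: "unitary_mat (2 ^ m) UNPREP"
      "mat_adjoint UNPREP *\<^sub>v ket m 0 =
         complex_of_real (1 / sqrt (\<Sum>k<N. v_data s t k)) \<cdot>\<^sub>v
         finsum_vec TYPE(complex) (2 ^ m)
           (\<lambda>k. complex_of_real (sqrt (v_data s t k)) \<cdot>\<^sub>v ket m k) {..<N}"
  shows "block_encoding m n
           ((UNPREP \<otimes>\<^sub>m 1\<^sub>m (2 ^ (n + 1))) * O_del * O_shift * (PREP \<otimes>\<^sub>m 1\<^sub>m (2 ^ (n + 1))))
           (\<Sum>k<N. v_data s t k) A"
proof -
  define \<alpha> where "\<alpha> = (\<Sum>k<N. v_data s t k)"
  define W where "W = O_del * O_shift"
  define P' Q' where "P' = PREP \<otimes>\<^sub>m 1\<^sub>m (2 ^ (n + 1))" and "Q' = UNPREP \<otimes>\<^sub>m 1\<^sub>m (2 ^ (n + 1))"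
  have dims: "(2::nat) ^ (m + 1 + n) = 2 ^ m * 2 ^ (n + 1)" by (simp add: power_add)
  have Wu: "unitary_mat (2 ^ (m + 1 + n)) W"
    unfolding W_def by (rule unitary_mat_mult[OF O_del(1) O_shift(1)])
  have P'u: "unitary_mat (2 ^ (m + 1 + n)) P'"
    unfolding P'_def dims by (rule unitary_mat_kron[OF PREP(1) unitary_mat_one])
  have Q'u: "unitary_mat (2 ^ (m + 1 + n)) Q'"
    unfolding Q'_def dims by (rule unitary_mat_kron[OF UNPREP(1) unitary_mat_one])
  have oc: "O_del \<in> carrier_mat (2 ^ (m + 1 + n)) (2 ^ (m + 1 + n))"
    "O_shift \<in> carrier_mat (2 ^ (m + 1 + n)) (2 ^ (m + 1 + n))"
    "Q' \<in> carrier_mat (2 ^ (m + 1 + n)) (2 ^ (m + 1 + n))"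
    using O_del(1) O_shift(1) Q'u by (auto simp: unitary_mat_def)
  \<comment> \<open>Regrouping presents the two oracles as the single middle operator of
    \<open>braket_select\<close>.\<close>
  have U: "Q' * O_del * O_shift * P' = Q' * W * P'"
    unfolding W_def using oc by (simp add: assoc_mult_mat[OF oc(3) oc(1) oc(2)])
  \<comment> \<open>An infinite set has \<open>card\<close> zero, so finiteness is taken from the
    bijection with \<open>{0..<N}\<close>.\<close>
  have fin: "finite (items n A s)"
    using t bij_betw_finite by blast
  have v_nonneg: "v_data s t k \<ge> 0" for k
    by (simp add: v_data_def split: prod.split)
  have \<alpha>: "\<alpha> \<ge> 0"
    unfolding \<alpha>_def by (rule sum_nonneg) (rule v_nonneg)
  have entry: "braket (state m n 0 0 i) (Q' * W * P') (state m n 0 0 j) =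
      A $$ (i, j) / complex_of_real \<alpha>" if i: "i < 2 ^ n" and j: "j < 2 ^ n" for i j
  proof -
    let ?\<chi> = "\<lambda>k. del_flag n A s t k (shift n t k j)"
    let ?c = "complex_of_real (1 / sqrt \<alpha>)"
    let ?a = "\<lambda>k. v_sign s t k * complex_of_real (sqrt (v_data s t k))"
    let ?b = "\<lambda>k. complex_of_real (sqrt (v_data s t k))"
    let ?g = "\<lambda>(d, l, c). if d = int i - int j \<and> A $$ (i, j) = s d l
      then complex_of_real (part_of c (s d l)) * part_unit c else 0"
    \<comment> \<open>The delete qubit starts in \<open>0\<close>, so addition modulo 2 leaves
      exactly the flag.\<close>
    have W_state: "W *\<^sub>v state m n k 0 j = state m n k (?\<chi> k) (shift n t k j)" if k: "k < N" for k
    proof -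
      have "W *\<^sub>v state m n k 0 j = O_del *\<^sub>v (O_shift *\<^sub>v state m n k 0 j)"
        unfolding W_def by (rule assoc_mult_mat_vec[OF oc(1,2) state_carrier])
      then show ?thesis
        using O_shift(2) O_del(2) k j by (simp add: del_flag_def)
    qed
    have "braket (state m n 0 0 i) (Q' * W * P') (state m n 0 0 j) =
        ?c * cnj ?c * (\<Sum>k<N. if ?\<chi> k = 0 \<and> shift n t k j = i then ?a k * cnj (?b k) else 0)"
      unfolding P'_def Q'_def
    proof (rule braket_select[OF PREP(1) UNPREP(1) _ le_two_power_log[OF m]])
      show "shift n t k j < 2 ^ n" for k
        by (simp add: shift_def nat_less_iff)
    qed (use Wu PREP(2) UNPREP(2) W_state i in \<open>auto simp: unitary_mat_def \<alpha>_def del_flag_def\<close>)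
    also have "(\<Sum>k<N. if ?\<chi> k = 0 \<and> shift n t k j = i then ?a k * cnj (?b k) else 0) =
        (\<Sum>k<N. ?g (t k))"
    proof (rule sum.cong)
      fix k
      obtain d l c where tk: "t k = (d, l, c)" by (cases "t k")
      have "?\<chi> k = 0 \<and> shift n t k j = i \<longleftrightarrow> d = int i - int j \<and> A $$ (i, j) = s d l"
        using mem_value_rows_shift_iff[OF i j, of d A "s d l"]
        by (auto simp: del_flag_def shift_def item_rows_def offset_def tk)
      \<comment> \<open>Each preparation supplies one square root of the absolute value; the sign
        and the unit from \<open>v_sign\<close> restore the signed real or imaginary part.\<close>
      moreover have "?a k * cnj (?b k) = complex_of_real (part_of c (s d l)) * part_unit c"
      proof -
        have "?b k * cnj (?b k) = complex_of_real \<bar>part_of c (s d l)\<bar>"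
          by (simp add: v_data_def tk flip: of_real_mult)
        then have "?a k * cnj (?b k) = complex_of_real (sgn (part_of c (s d l)) * \<bar>part_of c (s d l)\<bar>) * part_unit c"
          by (simp add: v_sign_def tk mult_ac)
        then show ?thesis by (simp add: sgn_mult_abs)
      qed
      ultimately show "(if ?\<chi> k = 0 \<and> shift n t k j = i then ?a k * cnj (?b k) else 0) = ?g (t k)"
        by (simp add: tk)
    qed simp
    also have "\<dots> = sum ?g (items n A s)"
      using sum.reindex_bij_betw[OF t, of ?g] by (simp add: atLeast0LessThan)
    also have "\<dots> = A $$ (i, j)" by (rule sum_items_eq_entry[OF s fin i j])
    \<comment> \<open>The two normalizations are equal and real; nonnegativity of
      \<open>\<alpha>\<close> turns the product of the square roots into
      \<open>\<alpha>\<close>.\<close>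
    also have "?c * cnj ?c = complex_of_real (1 / \<alpha>)"
      using \<alpha> by (simp flip: of_real_mult)
    finally show ?thesis by simp
  qed
  show ?thesis
    unfolding block_encoding_def P'_def[symmetric] Q'_def[symmetric] \<alpha>_def[symmetric] U
    using unitary_mat_mult[OF unitary_mat_mult[OF Q'u Wu] P'u] entry by blast
qed

end
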